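(* Let $R$ be a ring, $S$ a simple $R$-module, and let $t$ and $q$ be natural numbers such that $|\mathrm{End}_R(S)| = q$. Then $$\mu_R(S^t) = (-1)^{t}\, q^{\frac{t(t-1)}{2}}.$$
   Context: Rings are associative with unity (not necessarily commutative); modules are left modules. For an $R$-module $M$ with a finite set $\mathcal{L}(M)$ of submodules, the integer $\mu_R(M)$ is defined recursively by $\mu_R(0):=1$ and, for $M\neq 0$, by requiring $\sum_{N\in\mathcal{L}(M)}\mu_R(N)=0$ (the sum includes $N=M$). Under the hypotheses, $S^t$ has only finitely many submodules, so $\mu_R(S^t)$ is defined. *)

theory Defs
  imports "HOL-Algebra.Module" "HOL-Library.FuncSet"
begin

text \<open>
  The library's locale \<open>module\<close> requires a commutative ring of scalars. The following locale has
  the same axioms over a ring that need not be commutative; as in \<open>module\<close>, only the additive and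
  the scalar structure of the record are used, its multiplication and unit are ignored.
\<close>

locale left_module = R?: ring R + M?: abelian_group M for R (structure) and M (structure) +
  assumes smult_closed [simp, intro]:
      "\<lbrakk>a \<in> carrier R; x \<in> carrier M\<rbrakk> \<Longrightarrow> a \<odot>\<^bsub>M\<^esub> x \<in> carrier M"
    and smult_l_distr:
      "\<lbrakk>a \<in> carrier R; b \<in> carrier R; x \<in> carrier M\<rbrakk> \<Longrightarrow>
      (a \<oplus> b) \<odot>\<^bsub>M\<^esub> x = a \<odot>\<^bsub>M\<^esub> x \<oplus>\<^bsub>M\<^esub> b \<odot>\<^bsub>M\<^esub> x"
    and smult_r_distr:
      "\<lbrakk>a \<in> carrier R; x \<in> carrier M; y \<in> carrier M\<rbrakk> \<Longrightarrow>
      a \<odot>\<^bsub>M\<^esub> (x \<oplus>\<^bsub>M\<^esub> y) = a \<odot>\<^bsub>M\<^esub> x \<oplus>\<^bsub>M\<^esub> a \<odot>\<^bsub>M\<^esub> y"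
    and smult_assoc1:
      "\<lbrakk>a \<in> carrier R; b \<in> carrier R; x \<in> carrier M\<rbrakk> \<Longrightarrow>
      (a \<otimes> b) \<odot>\<^bsub>M\<^esub> x = a \<odot>\<^bsub>M\<^esub> (b \<odot>\<^bsub>M\<^esub> x)"
    and smult_one [simp]:
      "x \<in> carrier M \<Longrightarrow> \<one> \<odot>\<^bsub>M\<^esub> x = x"

definition submodules :: "('a, 'c) ring_scheme \<Rightarrow> ('a, 'b, 'm) module_scheme \<Rightarrow> 'b set set" where
  "submodules R M = {N. submodule N R M}"

locale simple_left_module = left_module +
  assumes carrier_nonzero: "carrier M \<noteq> {\<zero>\<^bsub>M\<^esub>}"
    and submodule_trivial: "submodule N R M \<Longrightarrow> N = {\<zero>\<^bsub>M\<^esub>} \<or> N = carrier M"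

text \<open>
  Endomorphisms are taken to be extensional (\<open>undefined\<close> off the carrier), so that each map on
  the carrier is counted exactly once.
\<close>

definition module_End ::
  "('a, 'c) ring_scheme \<Rightarrow> ('a, 'b, 'm) module_scheme \<Rightarrow> ('b \<Rightarrow> 'b) set" where
  "module_End R M = {f \<in> carrier M \<rightarrow>\<^sub>E carrier M.
     (\<forall>x\<in>carrier M. \<forall>y\<in>carrier M. f (x \<oplus>\<^bsub>M\<^esub> y) = f x \<oplus>\<^bsub>M\<^esub> f y) \<and>
     (\<forall>a\<in>carrier R. \<forall>x\<in>carrier M. f (a \<odot>\<^bsub>M\<^esub> x) = a \<odot>\<^bsub>M\<^esub> f x)}"

definition module_power ::
  "('a, 'b, 'm) module_scheme \<Rightarrow> nat \<Rightarrow> ('a, nat \<Rightarrow> 'b) module" where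
  "module_power M t =
    \<lparr>carrier = (\<Pi>\<^sub>E i\<in>{..<t}. carrier M),
     monoid.mult = (\<lambda>x y. \<lambda>i\<in>{..<t}. x i \<otimes>\<^bsub>M\<^esub> y i),
     one = (\<lambda>i\<in>{..<t}. \<one>\<^bsub>M\<^esub>),
     zero = (\<lambda>i\<in>{..<t}. \<zero>\<^bsub>M\<^esub>),
     add = (\<lambda>x y. \<lambda>i\<in>{..<t}. x i \<oplus>\<^bsub>M\<^esub> y i),
     smult = (\<lambda>a x. \<lambda>i\<in>{..<t}. a \<odot>\<^bsub>M\<^esub> x i)\<rparr>"

lemma (in left_module) left_module_power: "left_module R (module_power M t)"
proof (intro left_module.intro left_module_axioms.intro)
  show "ring R" ..
  show "abelian_group (module_power M t)"
  proof (rule abelian_groupI)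
    fix x assume "x \<in> carrier (module_power M t)"
    then show "\<exists>y\<in>carrier (module_power M t).
        y \<oplus>\<^bsub>module_power M t\<^esub> x = \<zero>\<^bsub>module_power M t\<^esub>"
      by (intro bexI[of _ "\<lambda>i\<in>{..<t}. \<ominus>\<^bsub>M\<^esub> x i"])
         (auto simp: module_power_def M.l_neg PiE_iff intro!: restrict_ext)
  qed (auto simp: module_power_def PiE_iff M.a_ac extensional_def fun_eq_iff)
qed (auto simp: module_power_def PiE_iff smult_l_distr smult_r_distr smult_assoc1
       extensional_def fun_eq_iff)

lemma (in left_module) submodule_trans:
  assumes "submodule N R M" and "submodule K R (M\<lparr>carrier := N\<rparr>)"
  shows "submodule K R M"
proof -
  have "subgroup K (add_monoid M)"
    using M.add.incl_subgroup[of N K] assms by (simp add: submodule_def)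
  then show ?thesis
    using assms(2) by (simp add: submodule_def submodule_axioms_def)
qed

lemma (in left_module) carrier_in_submodules: "carrier M \<in> submodules R M"
  using M.add.subgroup_self by (auto simp: submodules_def submodule_def submodule_axioms_def)

lemma (in left_module) submodules_psubset:
  assumes "N \<in> submodules R M" and "N \<noteq> carrier M"
  shows "submodules R (M\<lparr>carrier := N\<rparr>) \<subset> submodules R M"
proof -
  have "N \<subseteq> carrier M"
    using assms(1) subgroup.subset[of N "add_monoid M"]
    by (auto simp: submodules_def submodule_def)
  then have "\<not> carrier M \<subseteq> N"
    using assms(2) by blast
  then have "carrier M \<notin> submodules R (M\<lparr>carrier := N\<rparr>)"
    using subgroup.subset[of "carrier M" "add_monoid (M\<lparr>carrier := N\<rparr>)"]
    by (auto simp: submodules_def submodule_def)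
  moreover have "submodules R (M\<lparr>carrier := N\<rparr>) \<subseteq> submodules R M"
    using assms(1) submodule_trans by (auto simp: submodules_def)
  ultimately show ?thesis
    using carrier_in_submodules by blast
qed

text \<open>
  The defining condition of \<open>\<mu>\<close>, that the sum over all submodules of a nonzero module is zero, is
  solved here for the summand belonging to the whole module; see \<open>sum_submodule_mu\<close> below. A
  submodule is regarded as a module by restricting the carrier. The value \<open>0\<close> in the first case is
  a default for arguments that are not modules or have infinitely many submodules.
\<close>

function submodule_mu :: "('a, 'c) ring_scheme \<Rightarrow> ('a, 'b, 'm) module_scheme \<Rightarrow> int" where
  "submodule_mu R M =
    (if \<not> (left_module R M \<and> finite (submodules R M)) then 0
     else if carrier M = {\<zero>\<^bsub>M\<^esub>} then 1
     else - (\<Sum>N\<in>submodules R M - {carrier M}. submodule_mu R (M\<lparr>carrier := N\<rparr>)))"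
  by auto
termination
proof (relation "measure (\<lambda>(R, M). card (submodules R M))", goal_cases)
  case (2 R M N)
  then show ?case
    using left_module.submodules_psubset[of R M N] by (simp add: psubset_card_mono)
qed simp

declare submodule_mu.simps [simp del]

lemma submodule_mu_zero:
  assumes "left_module R M" and "carrier M = {\<zero>\<^bsub>M\<^esub>}"
  shows "submodule_mu R M = 1"
proof -
  have "submodules R M \<subseteq> Pow {\<zero>\<^bsub>M\<^esub>}"
    using assms(2) subgroup.subset[of _ "add_monoid M"]
    by (auto simp: submodules_def submodule_def)
  then have "finite (submodules R M)"
    by (rule finite_subset) simp
  with assms show ?thesis
    by (simp add: submodule_mu.simps)
qed

lemma sum_submodule_mu:
  assumes "left_module R M" and "finite (submodules R M)" and "carrier M \<noteq> {\<zero>\<^bsub>M\<^esub>}"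
  shows "(\<Sum>N\<in>submodules R M. submodule_mu R (M\<lparr>carrier := N\<rparr>)) = 0"
proof -
  have "submodule_mu R (M\<lparr>carrier := carrier M\<rparr>) =
      - (\<Sum>N\<in>submodules R M - {carrier M}. submodule_mu R (M\<lparr>carrier := N\<rparr>))"
    using assms by (subst submodule_mu.simps) simp
  then show ?thesis
    using sum.remove[OF assms(2) left_module.carrier_in_submodules[OF assms(1)],
        of "\<lambda>N. submodule_mu R (M\<lparr>carrier := N\<rparr>)"]
    by simp
qed

end

theory Submission
  imports Defs "HOL-Algebra.AbelCoset"
begin

text \<open>
  Weisner's theorem: for a nonzero submodule \<open>A\<close> of \<open>M\<close>, the values \<open>\<mu>(X)\<close> over all submodules \<open>X\<close>
  with \<open>X + A = M\<close> sum to zero. Take \<open>M = S\<^sup>t\<^sup>+\<^sup>1\<close> and let \<open>A\<close> be its last summand. As \<open>A\<close> is simple,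
  such an \<open>X\<close> is either \<open>M\<close> itself or a complement of \<open>A\<close>, that is, the graph of one of the \<open>q\<^sup>t\<close>
  homomorphisms \<open>S\<^sup>t \<rightarrow> S\<close>. A graph is isomorphic to \<open>S\<^sup>t\<close>, so \<open>\<mu>(S\<^sup>t\<^sup>+\<^sup>1) = - q\<^sup>t \<mu>(S\<^sup>t)\<close>.
  There are only finitely many submodules of \<open>S\<^sup>t\<close> because each is determined by the homomorphisms
  \<open>S \<rightarrow> S\<^sup>t\<close> with image in it.
\<close>

section \<open>Submodules over a possibly noncommutative ring\<close>

lemma (in left_module) smult_l_null:
  assumes "x \<in> carrier M"
  shows "\<zero> \<odot>\<^bsub>M\<^esub> x = \<zero>\<^bsub>M\<^esub>"
proof -
  have "\<zero> \<odot>\<^bsub>M\<^esub> x \<oplus>\<^bsub>M\<^esub> \<zero> \<odot>\<^bsub>M\<^esub> x = (\<zero> \<oplus> \<zero>) \<odot>\<^bsub>M\<^esub> x"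
    using assms by (subst smult_l_distr) auto
  then show ?thesis
    using assms by (simp add: M.add.r_cancel_one)
qed

lemma (in left_module) smult_minus_one:
  assumes "x \<in> carrier M"
  shows "(\<ominus> \<one>) \<odot>\<^bsub>M\<^esub> x = \<ominus>\<^bsub>M\<^esub> x"
proof -
  have "(\<ominus> \<one>) \<odot>\<^bsub>M\<^esub> x \<oplus>\<^bsub>M\<^esub> x = (\<ominus> \<one> \<oplus> \<one>) \<odot>\<^bsub>M\<^esub> x"
    using assms by (subst smult_l_distr) auto
  then have "(\<ominus> \<one>) \<odot>\<^bsub>M\<^esub> x \<oplus>\<^bsub>M\<^esub> x = \<zero>\<^bsub>M\<^esub>"
    using assms by (simp add: R.l_neg smult_l_null)
  then show ?thesis
    using assms by (simp add: M.minus_equality)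
qed

text \<open>Closure under negation comes from closure under scalars, because
  \<open>\<ominus> x\<close> is the multiple of \<open>x\<close> by \<open>\<ominus> \<one>\<close>.
  This elementwise form serves for nearly all later membership checks.\<close>

lemma (in left_module) submodule_iff:
  "submodule N R M \<longleftrightarrow> N \<subseteq> carrier M \<and> \<zero>\<^bsub>M\<^esub> \<in> N \<and>
    (\<forall>x\<in>N. \<forall>y\<in>N. x \<oplus>\<^bsub>M\<^esub> y \<in> N) \<and> (\<forall>a\<in>carrier R. \<forall>x\<in>N. a \<odot>\<^bsub>M\<^esub> x \<in> N)"
proof
  assume "submodule N R M"
  then interpret submodule N R M .
  show "N \<subseteq> carrier M \<and> \<zero>\<^bsub>M\<^esub> \<in> N \<and>
    (\<forall>x\<in>N. \<forall>y\<in>N. x \<oplus>\<^bsub>M\<^esub> y \<in> N) \<and> (\<forall>a\<in>carrier R. \<forall>x\<in>N. a \<odot>\<^bsub>M\<^esub> x \<in> N)"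
    using subset one_closed m_closed smult_closed by auto
next
  assume *: "N \<subseteq> carrier M \<and> \<zero>\<^bsub>M\<^esub> \<in> N \<and>
    (\<forall>x\<in>N. \<forall>y\<in>N. x \<oplus>\<^bsub>M\<^esub> y \<in> N) \<and> (\<forall>a\<in>carrier R. \<forall>x\<in>N. a \<odot>\<^bsub>M\<^esub> x \<in> N)"
  then have "\<ominus>\<^bsub>M\<^esub> x \<in> N" if "x \<in> N" for x
  proof -
    have "(\<ominus> \<one>) \<odot>\<^bsub>M\<^esub> x \<in> N"
      using * that by simp
    then show ?thesis
      using * that smult_minus_one[of x] by (metis subsetD)
  qed
  with * show "submodule N R M"
    by (auto simp: submodule_def submodule_axioms_def subgroup_def a_inv_def)
qed

lemma (in left_module) left_module_submodule:
  assumes "submodule N R M"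
  shows "left_module R (M\<lparr>carrier := N\<rparr>)"
proof -
  interpret N: submodule N R M by fact
  have "abelian_group (M\<lparr>carrier := N\<rparr>)"
  proof (rule abelian_groupI)
    fix x assume "x \<in> carrier (M\<lparr>carrier := N\<rparr>)"
    then have "\<ominus>\<^bsub>M\<^esub> x \<in> N" "x \<in> carrier M"
      using N.m_inv_closed N.subset by (auto simp: a_inv_def)
    then show "\<exists>y\<in>carrier (M\<lparr>carrier := N\<rparr>).
        y \<oplus>\<^bsub>M\<lparr>carrier := N\<rparr>\<^esub> x = \<zero>\<^bsub>M\<lparr>carrier := N\<rparr>\<^esub>"
      by (auto intro!: bexI[of _ "\<ominus>\<^bsub>M\<^esub> x"] simp: M.l_neg)
  next
    show "\<zero>\<^bsub>M\<lparr>carrier := N\<rparr>\<^esub> \<in> carrier (M\<lparr>carrier := N\<rparr>)"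
      using N.one_closed by simp
  qed (use N.subset N.m_closed in \<open>auto simp: subset_iff M.a_ac\<close>)
  moreover have "N \<subseteq> carrier M"
    using N.subset by simp
  ultimately show ?thesis
    by (auto intro!: left_module.intro left_module_axioms.intro R.ring_axioms
        smult_l_distr smult_r_distr smult_assoc1)
qed

text \<open>Turns the range of the recursion for a submodule \<open>N\<close> into the part below
  \<open>N\<close> of the submodule lattice of \<open>M\<close>, so that all sums of \<mu> can be
  compared inside one fixed lattice.\<close>

lemma (in left_module) submodules_submodule:
  assumes "submodule N R M"
  shows "submodules R (M\<lparr>carrier := N\<rparr>) = {X \<in> submodules R M. X \<subseteq> N}"
proof -
  have "N \<subseteq> carrier M"
    using assms by (simp add: submodule_iff)
  then have "submodule X R (M\<lparr>carrier := N\<rparr>) \<longleftrightarrow> submodule X R M \<and> X \<subseteq> N" for X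
    unfolding left_module.submodule_iff[OF left_module_submodule[OF assms]] submodule_iff
    by auto
  then show ?thesis
    unfolding submodules_def by simp
qed

section \<open>Linear maps and the transport of submodules\<close>

text \<open>Values off the carrier are left free, so that plain lambda terms and composites qualify.
  Extensionality is added only in \<open>module_Hom\<close>, where maps have to be counted.\<close>

definition linear_map ::
  "('a, 'c) ring_scheme \<Rightarrow> ('a, 'b, 'm) module_scheme \<Rightarrow> ('a, 'd, 'n) module_scheme \<Rightarrow> ('b \<Rightarrow> 'd) \<Rightarrow> bool"
  where "linear_map R M N f \<longleftrightarrow> f \<in> carrier M \<rightarrow> carrier N \<and>
     (\<forall>x\<in>carrier M. \<forall>y\<in>carrier M. f (x \<oplus>\<^bsub>M\<^esub> y) = f x \<oplus>\<^bsub>N\<^esub> f y) \<and>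
     (\<forall>a\<in>carrier R. \<forall>x\<in>carrier M. f (a \<odot>\<^bsub>M\<^esub> x) = a \<odot>\<^bsub>N\<^esub> f x)"

definition module_Hom ::
  "('a, 'c) ring_scheme \<Rightarrow> ('a, 'b, 'm) module_scheme \<Rightarrow> ('a, 'd, 'n) module_scheme \<Rightarrow> ('b \<Rightarrow> 'd) set"
  where "module_Hom R M N = {f \<in> extensional (carrier M). linear_map R M N f}"

lemma module_End_eq_Hom: "module_End R M = module_Hom R M M"
  by (auto simp: module_End_def module_Hom_def linear_map_def PiE_def)

lemma linear_mapD:
  assumes "linear_map R M N f"
  shows "x \<in> carrier M \<Longrightarrow> f x \<in> carrier N"
    and "x \<in> carrier M \<Longrightarrow> y \<in> carrier M \<Longrightarrow> f (x \<oplus>\<^bsub>M\<^esub> y) = f x \<oplus>\<^bsub>N\<^esub> f y"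
    and "a \<in> carrier R \<Longrightarrow> x \<in> carrier M \<Longrightarrow> f (a \<odot>\<^bsub>M\<^esub> x) = a \<odot>\<^bsub>N\<^esub> f x"
  using assms by (auto simp: linear_map_def)

lemma linear_map_zero:
  assumes "left_module R M" "left_module R N" "linear_map R M N f"
  shows "f \<zero>\<^bsub>M\<^esub> = \<zero>\<^bsub>N\<^esub>"
proof -
  interpret M: left_module R M by fact
  interpret N: left_module R N by fact
  have "f (\<zero>\<^bsub>R\<^esub> \<odot>\<^bsub>M\<^esub> \<zero>\<^bsub>M\<^esub>) = \<zero>\<^bsub>R\<^esub> \<odot>\<^bsub>N\<^esub> f \<zero>\<^bsub>M\<^esub>"
    by (rule linear_mapD(3)[OF assms(3)]) auto
  then show ?thesis
    using linear_mapD(1)[OF assms(3)] by (simp add: M.smult_l_null N.smult_l_null)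
qed

lemma linear_map_cong:
  assumes "left_module R M" "\<And>x. x \<in> carrier M \<Longrightarrow> f x = g x"
  shows "linear_map R M N f \<longleftrightarrow> linear_map R M N g"
proof -
  interpret M: left_module R M by fact
  show ?thesis
    using assms(2) by (auto simp: linear_map_def Pi_iff)
qed

lemma linear_map_restrict:
  assumes "submodule X R M" "left_module R M" "linear_map R M N f" "f ` X \<subseteq> Y"
  shows "linear_map R (M\<lparr>carrier := X\<rparr>) (N\<lparr>carrier := Y\<rparr>) f"
proof -
  interpret M: left_module R M by fact
  show ?thesis
    using assms by (auto simp: linear_map_def M.submodule_iff subset_iff)
qed

lemma submodule_image:
  assumes "left_module R M" "left_module R N" "linear_map R M N f" "submodule X R M"
  shows "submodule (f ` X) R N"
proof -
  interpret M: left_module R M by fact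
  interpret N: left_module R N by fact
  have X: "X \<subseteq> carrier M" "\<zero>\<^bsub>M\<^esub> \<in> X"
      "\<And>x y. x \<in> X \<Longrightarrow> y \<in> X \<Longrightarrow> x \<oplus>\<^bsub>M\<^esub> y \<in> X"
      "\<And>a x. a \<in> carrier R \<Longrightarrow> x \<in> X \<Longrightarrow> a \<odot>\<^bsub>M\<^esub> x \<in> X"
    using assms(4) by (auto simp: M.submodule_iff)
  have "f x \<oplus>\<^bsub>N\<^esub> f y \<in> f ` X" if "x \<in> X" "y \<in> X" for x y
    using that X linear_mapD(2)[OF assms(3), of x y] by (metis image_eqI subsetD)
  moreover have "a \<odot>\<^bsub>N\<^esub> f x \<in> f ` X" if "a \<in> carrier R" "x \<in> X" for a x
    using that X linear_mapD(3)[OF assms(3), of a x] by (metis image_eqI subsetD)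
  moreover have "\<zero>\<^bsub>N\<^esub> \<in> f ` X"
    using linear_map_zero[OF assms(1-3)] X(2) by (metis image_eqI)
  ultimately show ?thesis
    using X(1) linear_mapD(1)[OF assms(3)] by (auto simp: N.submodule_iff)
qed

lemma submodule_vimage:
  assumes "left_module R M" "left_module R N" "linear_map R M N f" "submodule Y R N"
  shows "submodule {x \<in> carrier M. f x \<in> Y} R M"
proof -
  interpret M: left_module R M by fact
  interpret N: left_module R N by fact
  show ?thesis
    using assms(4) linear_map_zero[OF assms(1-3)] linear_mapD[OF assms(3)]
    by (auto simp: M.submodule_iff N.submodule_iff)
qed

section \<open>Invariance of \<mu> under isomorphism\<close>

text \<open>Taking preimages inverts taking images: one composite is the identity by injectivity of
  \<open>f\<close>, the other by surjectivity.\<close>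

lemma bij_betw_submodules:
  assumes "left_module R M" "left_module R N" "linear_map R M N f"
    and bij: "bij_betw f (carrier M) (carrier N)"
  shows "bij_betw ((`) f) (submodules R M) (submodules R N)"
proof (rule bij_betw_byWitness[where f' = "\<lambda>Y. {x \<in> carrier M. f x \<in> Y}"])
  interpret M: left_module R M by fact
  interpret N: left_module R N by fact
  show "\<forall>X\<in>submodules R M. {x \<in> carrier M. f x \<in> f ` X} = X"
    using bij by (auto simp: submodules_def M.submodule_iff bij_betw_def inj_on_def)
  show "\<forall>Y\<in>submodules R N. f ` {x \<in> carrier M. f x \<in> Y} = Y"
    proof
    fix Y assume "Y \<in> submodules R N"
    then have "Y \<subseteq> f ` carrier M"
      using bij by (simp add: submodules_def N.submodule_iff bij_betw_def)
    then show "f ` {x \<in> carrier M. f x \<in> Y} = Y"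
      by auto
  qed
  show "(`) f ` submodules R M \<subseteq> submodules R N"
    using submodule_image[OF assms(1-3)] by (auto simp: submodules_def)
  show "(\<lambda>Y. {x \<in> carrier M. f x \<in> Y}) ` submodules R N \<subseteq> submodules R M"
    using submodule_vimage[OF assms(1-3)] by (auto simp: submodules_def)
qed

text \<open>Induction along the recursion of \<open>submodule_mu\<close>: \<open>f\<close> restricts
  to an isomorphism from each proper submodule of \<open>M\<close> onto its image, so the two
  defining sums agree term by term.\<close>

lemma submodule_mu_iso:
  assumes "left_module R M" "left_module R N" "linear_map R M N f"
    and "bij_betw f (carrier M) (carrier N)"
  shows "submodule_mu R M = submodule_mu R N"
  using assms
proof (induction R M arbitrary: N rule: submodule_mu.induct)
  case (1 R M)
  interpret M: left_module R M by fact
  interpret N: left_module R N by fact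
  note bij = bij_betw_submodules[OF "1.prems"]
  have im: "f ` carrier M = carrier N" and inj: "inj_on f (carrier M)"
    using "1.prems" by (auto simp: bij_betw_def)
  \<comment> \<open>Together with \<open>fin\<close>, this puts both modules into the same branch of
    the definition of \<open>submodule_mu\<close>.\<close>
  have z: "carrier M = {\<zero>\<^bsub>M\<^esub>} \<longleftrightarrow> carrier N = {\<zero>\<^bsub>N\<^esub>}"
  proof
    assume "carrier M = {\<zero>\<^bsub>M\<^esub>}"
    then show "carrier N = {\<zero>\<^bsub>N\<^esub>}"
      using im linear_map_zero[OF "1.prems"(1-3)] by auto
  next
    assume "carrier N = {\<zero>\<^bsub>N\<^esub>}"
    then have "x = \<zero>\<^bsub>M\<^esub>" if "x \<in> carrier M" for x
      using that im inj by (metis M.zero_closed image_eqI inj_onD singletonD)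
    then show "carrier M = {\<zero>\<^bsub>M\<^esub>}"
      by auto
  qed
  have fin: "finite (submodules R M) \<longleftrightarrow> finite (submodules R N)"
    using bij by (rule bij_betw_finite)
  show ?case
  proof (cases "finite (submodules R M) \<and> carrier M \<noteq> {\<zero>\<^bsub>M\<^esub>}")
    case True
    have bij': "bij_betw ((`) f) (submodules R M - {carrier M}) (submodules R N - {carrier N})"
      using bij_betw_DiffI[OF bij, of "{carrier M}" "{carrier N}"]
      by (auto simp: im bij_betw_def M.carrier_in_submodules N.carrier_in_submodules)
    have "submodule_mu R (M\<lparr>carrier := X\<rparr>) = submodule_mu R (N\<lparr>carrier := f ` X\<rparr>)"
      if X: "X \<in> submodules R M - {carrier M}" for X
    proof (rule "1.IH")
      show "\<not> \<not> (left_module R M \<and> finite (submodules R M))" "carrier M \<noteq> {\<zero>\<^bsub>M\<^esub>}"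
        using True "1.prems" by auto
      have X': "submodule X R M"
        using X by (simp add: submodules_def)
      show "left_module R (M\<lparr>carrier := X\<rparr>)"
        using X' by (rule M.left_module_submodule)
      show "left_module R (N\<lparr>carrier := f ` X\<rparr>)"
        using submodule_image[OF "1.prems"(1-3) X'] by (rule N.left_module_submodule)
      show "linear_map R (M\<lparr>carrier := X\<rparr>) (N\<lparr>carrier := f ` X\<rparr>) f"
        using "1.prems" X' by (auto intro: linear_map_restrict)
      show "bij_betw f (carrier (M\<lparr>carrier := X\<rparr>)) (carrier (N\<lparr>carrier := f ` X\<rparr>))"
        using X' inj by (auto simp: M.submodule_iff bij_betw_def intro: inj_on_subset)
    qed (use X in auto)
    then have "(\<Sum>X\<in>submodules R M - {carrier M}. submodule_mu R (M\<lparr>carrier := X\<rparr>)) =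
        (\<Sum>Y\<in>submodules R N - {carrier N}. submodule_mu R (N\<lparr>carrier := Y\<rparr>))"
      by (subst sum.reindex_bij_betw[OF bij', symmetric]) (rule sum.cong, auto)
    then show ?thesis
      using True fin z "1.prems"(1,2)
      by (subst (1 2) submodule_mu.simps) simp
  next
    case False
    then show ?thesis
      using z fin "1.prems"(1,2) by (subst (1 2) submodule_mu.simps) auto
  qed
qed

section \<open>Sums of submodules and Weisner's theorem\<close>

context left_module
begin

lemma submodule_set_add:
  assumes "submodule X R M" "submodule Y R M"
  shows "submodule (X <+>\<^bsub>M\<^esub> Y) R M"
proof -
  have X: "X \<subseteq> carrier M" "\<zero>\<^bsub>M\<^esub> \<in> X"
      "\<And>x y. x \<in> X \<Longrightarrow> y \<in> X \<Longrightarrow> x \<oplus>\<^bsub>M\<^esub> y \<in> X"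
      "\<And>a x. a \<in> carrier R \<Longrightarrow> x \<in> X \<Longrightarrow> a \<odot>\<^bsub>M\<^esub> x \<in> X"
    using assms(1) by (auto simp: submodule_iff)
  have Y: "Y \<subseteq> carrier M" "\<zero>\<^bsub>M\<^esub> \<in> Y"
      "\<And>x y. x \<in> Y \<Longrightarrow> y \<in> Y \<Longrightarrow> x \<oplus>\<^bsub>M\<^esub> y \<in> Y"
      "\<And>a x. a \<in> carrier R \<Longrightarrow> x \<in> Y \<Longrightarrow> a \<odot>\<^bsub>M\<^esub> x \<in> Y"
    using assms(2) by (auto simp: submodule_iff)
  have add_mem: "x \<oplus>\<^bsub>M\<^esub> y \<in> X <+>\<^bsub>M\<^esub> Y" if "x \<in> X" "y \<in> Y" for x y
    using that by (auto simp: set_add_def')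
  have "\<zero>\<^bsub>M\<^esub> \<in> X <+>\<^bsub>M\<^esub> Y"
    using add_mem[OF X(2) Y(2)] by simp
  moreover have "u \<oplus>\<^bsub>M\<^esub> v \<in> X <+>\<^bsub>M\<^esub> Y"
    if "u \<in> X <+>\<^bsub>M\<^esub> Y" "v \<in> X <+>\<^bsub>M\<^esub> Y" for u v
  proof -
    obtain x y where "x \<in> X" "y \<in> Y" "u = x \<oplus>\<^bsub>M\<^esub> y"
      using \<open>u \<in> _\<close> unfolding set_add_def' by blast
    moreover obtain x' y' where "x' \<in> X" "y' \<in> Y" "v = x' \<oplus>\<^bsub>M\<^esub> y'"
      using \<open>v \<in> _\<close> unfolding set_add_def' by blast
    ultimately have *: "x \<in> X" "y \<in> Y" "u = x \<oplus>\<^bsub>M\<^esub> y" "x' \<in> X" "y' \<in> Y" "v = x' \<oplus>\<^bsub>M\<^esub> y'"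
      by auto
    have c: "x \<in> carrier M" "y \<in> carrier M" "x' \<in> carrier M" "y' \<in> carrier M"
      using * X(1) Y(1) by auto
    then have "u \<oplus>\<^bsub>M\<^esub> v = (x \<oplus>\<^bsub>M\<^esub> x') \<oplus>\<^bsub>M\<^esub> (y \<oplus>\<^bsub>M\<^esub> y')"
      using * by (simp add: M.a_ac)
    then show ?thesis
      using * by (simp add: add_mem X(3) Y(3))
  qed
  moreover have "a \<odot>\<^bsub>M\<^esub> u \<in> X <+>\<^bsub>M\<^esub> Y" if u: "a \<in> carrier R" "u \<in> X <+>\<^bsub>M\<^esub> Y" for a u
  proof -
    obtain x y where *: "x \<in> X" "y \<in> Y" "u = x \<oplus>\<^bsub>M\<^esub> y"
      using u(2) unfolding set_add_def' by blast
    then have "a \<odot>\<^bsub>M\<^esub> u = a \<odot>\<^bsub>M\<^esub> x \<oplus>\<^bsub>M\<^esub> a \<odot>\<^bsub>M\<^esub> y"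
      using u(1) subsetD[OF X(1)] subsetD[OF Y(1)] by (simp add: smult_r_distr)
    then show ?thesis
      using * u(1) by (simp add: add_mem X(4) Y(4))
  qed
  ultimately show ?thesis
    using X(1) Y(1) by (auto simp: submodule_iff M.set_add_closed)
qed

text \<open>Makes the sum the join of the submodule lattice. In the grouping argument below it
  places each \<open>X + A\<close> with \<open>X \<subseteq> Y\<close> between \<open>A\<close> and
  \<open>Y\<close>.\<close>

lemma set_add_subset_iff:
  assumes "submodule X R M" "submodule Y R M" "submodule Z R M"
  shows "X <+>\<^bsub>M\<^esub> Y \<subseteq> Z \<longleftrightarrow> X \<subseteq> Z \<and> Y \<subseteq> Z"
proof
  have "x \<in> X <+>\<^bsub>M\<^esub> Y" if "x \<in> X" for x
  proof -
    have "x = x \<oplus>\<^bsub>M\<^esub> \<zero>\<^bsub>M\<^esub>"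
      using that assms(1) by (auto simp: submodule_iff)
    then show ?thesis
      using that assms(2) unfolding set_add_def' submodule_iff by blast
  qed
  moreover have "y \<in> X <+>\<^bsub>M\<^esub> Y" if "y \<in> Y" for y
  proof -
    have "y = \<zero>\<^bsub>M\<^esub> \<oplus>\<^bsub>M\<^esub> y"
      using that assms(2) by (auto simp: submodule_iff)
    then show ?thesis
      using that assms(1) unfolding set_add_def' submodule_iff by blast
  qed
  ultimately show "X <+>\<^bsub>M\<^esub> Y \<subseteq> Z \<Longrightarrow> X \<subseteq> Z \<and> Y \<subseteq> Z"
    by blast
  show "X \<subseteq> Z \<and> Y \<subseteq> Z \<Longrightarrow> X <+>\<^bsub>M\<^esub> Y \<subseteq> Z"
    using assms(3) unfolding submodule_iff set_add_def' by blast
qed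

text \<open>
  Grouping the submodules \<open>X\<close> of \<open>Y\<close> by \<open>X + A\<close> splits the vanishing sum of \<open>\<mu>\<close> over them into sums
  of the same shape for submodules between \<open>A\<close> and \<open>Y\<close>.
\<close>

lemma sum_mu_set_add_eq:
  assumes fin: "finite (submodules R M)" and A: "submodule A R M" "A \<noteq> {\<zero>\<^bsub>M\<^esub>}"
    and "submodule Y R M" "A \<subseteq> Y"
  shows "(\<Sum>X | X \<in> submodules R M \<and> X <+>\<^bsub>M\<^esub> A = Y. submodule_mu R (M\<lparr>carrier := X\<rparr>)) = 0"
  using assms(4,5)
\<comment> \<open>Any \<open>Z\<close> with \<open>A \<subseteq> Z \<subset> Y\<close> has fewer
  submodules below it than \<open>Y\<close>, so its group of summands vanishes by induction.\<close>
proof (induction "card {X \<in> submodules R M. X \<subseteq> Y}" arbitrary: Y rule: less_induct)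
  case less
  define \<mu> where "\<mu> X = submodule_mu R (M\<lparr>carrier := X\<rparr>)" for X
  let ?L = "{X \<in> submodules R M. X \<subseteq> Y}"
  let ?U = "{Z \<in> submodules R M. A \<subseteq> Z \<and> Z \<subseteq> Y}"
  \<comment> \<open>The sum of \<mu> over the submodules of \<open>Y\<close> vanishes only for
    nonzero \<open>Y\<close>; here \<open>A \<noteq> {0}\<close> enters.\<close>
  have "Y \<noteq> {\<zero>\<^bsub>M\<^esub>}"
    using A less.prems by (auto simp: submodule_iff)
  then have "0 = (\<Sum>X\<in>?L. \<mu> X)"
    using sum_submodule_mu[OF left_module_submodule[OF less.prems(1)]] fin
    by (simp add: submodules_submodule[OF less.prems(1)] \<mu>_def)
  also have "\<dots> = (\<Sum>Z\<in>?U. \<Sum>X | X \<in> ?L \<and> X <+>\<^bsub>M\<^esub> A = Z. \<mu> X)"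
  proof (rule sum.group[symmetric])
    have "submodule (X <+>\<^bsub>M\<^esub> A) R M \<and> A \<subseteq> X <+>\<^bsub>M\<^esub> A \<and> X <+>\<^bsub>M\<^esub> A \<subseteq> Y"
      if "submodule X R M" "X \<subseteq> Y" for X
      using that less.prems set_add_subset_iff[OF that(1) A(1)] submodule_set_add[OF that(1) A(1)]
      by blast
    then show "(\<lambda>X. X <+>\<^bsub>M\<^esub> A) ` ?L \<subseteq> ?U"
      by (auto simp only: submodules_def)
  qed (use fin in auto)
  \<comment> \<open>From \<open>X + A = Z \<subseteq> Y\<close> follows
    \<open>X \<subseteq> Y\<close>, so the inner sums take the shape of the induction hypothesis,
    free of \<open>Y\<close>.\<close>
  also have "\<dots> = (\<Sum>Z\<in>?U. \<Sum>X | X \<in> submodules R M \<and> X <+>\<^bsub>M\<^esub> A = Z. \<mu> X)"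
  proof (intro sum.cong refl)
    fix Z assume "Z \<in> ?U"
    then show "{X. X \<in> ?L \<and> X <+>\<^bsub>M\<^esub> A = Z} = {X. X \<in> submodules R M \<and> X <+>\<^bsub>M\<^esub> A = Z}"
      using set_add_subset_iff[OF _ A(1), of _ Z] unfolding submodules_def by blast
  qed
  also have "\<dots> = (\<Sum>Z\<in>?U. if Z = Y then (\<Sum>X | X \<in> submodules R M \<and> X <+>\<^bsub>M\<^esub> A = Y. \<mu> X) else 0)"
  proof (intro sum.cong refl)
    fix Z assume Z: "Z \<in> ?U"
    show "(\<Sum>X | X \<in> submodules R M \<and> X <+>\<^bsub>M\<^esub> A = Z. \<mu> X) =
      (if Z = Y then (\<Sum>X | X \<in> submodules R M \<and> X <+>\<^bsub>M\<^esub> A = Y. \<mu> X) else 0)"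
    proof (cases "Z = Y")
      case False
      have "{X \<in> submodules R M. X \<subseteq> Z} \<subset> ?L"
        using False Z less.prems by (auto simp: submodules_def)
      then have "card {X \<in> submodules R M. X \<subseteq> Z} < card ?L"
        using fin by (intro psubset_card_mono) auto
      then show ?thesis
        using less.hyps[of Z] Z False by (simp add: submodules_def \<mu>_def)
    qed simp
  qed
  also have "\<dots> = (\<Sum>X | X \<in> submodules R M \<and> X <+>\<^bsub>M\<^esub> A = Y. \<mu> X)"
    using fin less.prems by (simp add: sum.delta submodules_def)
  finally show ?case
    by (simp add: \<mu>_def)
qed

end

section \<open>Composition, restriction and inversion of linear maps\<close>

lemma linear_map_compose:
  assumes "linear_map R L M f" "linear_map R M N g"
  shows "linear_map R L N (\<lambda>x. g (f x))"
  using assms by (auto simp: linear_map_def Pi_iff)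

lemma linear_map_subdomain:
  assumes "left_module R M" "submodule X R M" "linear_map R M N f"
  shows "linear_map R (M\<lparr>carrier := X\<rparr>) N f"
proof -
  interpret M: left_module R M by fact
  show ?thesis
    using assms(2,3) by (auto simp: linear_map_def M.submodule_iff subset_iff)
qed

lemma linear_map_inclusion:
  assumes "left_module R M" "submodule X R M"
  shows "linear_map R (M\<lparr>carrier := X\<rparr>) M (\<lambda>x. x)"
  using assms by (intro linear_map_subdomain) (auto simp: linear_map_def)

lemma linear_map_inj_on:
  assumes "left_module R M" "left_module R N" "linear_map R M N f"
    and ker: "\<And>x. x \<in> carrier M \<Longrightarrow> f x = \<zero>\<^bsub>N\<^esub> \<Longrightarrow> x = \<zero>\<^bsub>M\<^esub>"
  shows "inj_on f (carrier M)"
proof (rule inj_onI)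
  interpret M: left_module R M by fact
  interpret N: left_module R N by fact
  note f = linear_mapD[OF assms(3)]
  fix x y assume xy: "x \<in> carrier M" "y \<in> carrier M" "f x = f y"
  \<comment> \<open>The difference of \<open>x\<close> and \<open>y\<close> lies in the kernel. It
    is written with the scalar \<open>\<ominus> \<one>\<close> because linearity speaks of sums and
    scalar multiples.\<close>
  have "f (x \<oplus>\<^bsub>M\<^esub> (\<ominus>\<^bsub>R\<^esub> \<one>\<^bsub>R\<^esub>) \<odot>\<^bsub>M\<^esub> y) = f x \<oplus>\<^bsub>N\<^esub> (\<ominus>\<^bsub>R\<^esub> \<one>\<^bsub>R\<^esub>) \<odot>\<^bsub>N\<^esub> f y"
    using xy f by simp
  also have "\<dots> = \<zero>\<^bsub>N\<^esub>"
    using xy f by (simp add: N.smult_minus_one N.r_neg)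
  finally have "x \<oplus>\<^bsub>M\<^esub> (\<ominus>\<^bsub>M\<^esub> y) = \<zero>\<^bsub>M\<^esub>"
    using xy ker by (simp add: M.smult_minus_one)
  then show "x = y"
    using xy M.minus_equality[of x "\<ominus>\<^bsub>M\<^esub> y"] by simp
qed

lemma linear_map_inv_into:
  assumes "left_module R M" "linear_map R M N f" "bij_betw f (carrier M) (carrier N)"
  shows "linear_map R N M (inv_into (carrier M) f)"
proof -
  interpret M: left_module R M by fact
  let ?g = "inv_into (carrier M) f"
  have inj: "inj_on f (carrier M)"
    using assms(3) by (simp add: bij_betw_def)
  have g: "?g y \<in> carrier M" "f (?g y) = y" if "y \<in> carrier N" for y
    using that assms(3) by (auto simp: bij_betw_def inv_into_into f_inv_into_f)
  have "?g (x \<oplus>\<^bsub>N\<^esub> y) = ?g x \<oplus>\<^bsub>M\<^esub> ?g y" if "x \<in> carrier N" "y \<in> carrier N" for x y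
    using that g linear_mapD(2)[OF assms(2)] by (intro inv_into_f_eq[OF inj]) auto
  moreover have "?g (a \<odot>\<^bsub>N\<^esub> y) = a \<odot>\<^bsub>M\<^esub> ?g y" if "a \<in> carrier R" "y \<in> carrier N" for a y
    using that g linear_mapD(3)[OF assms(2)] by (intro inv_into_f_eq[OF inj]) auto
  ultimately show ?thesis
    using g by (auto simp: linear_map_def)
qed

lemma restrict_in_module_Hom:
  assumes "left_module R M" "linear_map R M N f"
  shows "restrict f (carrier M) \<in> module_Hom R M N"
proof -
  have "linear_map R M N (restrict f (carrier M)) \<longleftrightarrow> linear_map R M N f"
    by (rule linear_map_cong[OF assms(1)]) simp
  then show ?thesis
    using assms(2) by (simp add: module_Hom_def)
qed

section \<open>Coordinates in powers of a module\<close>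

lemma module_power_simps:
  "carrier (module_power M t) = {..<t} \<rightarrow>\<^sub>E carrier M"
  "\<zero>\<^bsub>module_power M t\<^esub> = (\<lambda>i\<in>{..<t}. \<zero>\<^bsub>M\<^esub>)"
  "x \<oplus>\<^bsub>module_power M t\<^esub> y = (\<lambda>i\<in>{..<t}. x i \<oplus>\<^bsub>M\<^esub> y i)"
  "a \<odot>\<^bsub>module_power M t\<^esub> x = (\<lambda>i\<in>{..<t}. a \<odot>\<^bsub>M\<^esub> x i)"
  by (simp_all add: module_power_def)

lemma module_power_eqI:
  assumes "x \<in> carrier (module_power M t)" "y \<in> carrier (module_power M t)"
    and "\<And>i. i < t \<Longrightarrow> x i = y i"
  shows "x = y"
  using assms by (auto simp: module_power_simps intro: PiE_ext)

text \<open>First half of the identification of the power with exponent \<open>Suc t\<close> with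
  the product of the power with exponent \<open>t\<close> and \<open>M\<close>: updating at
  \<open>t\<close> appends a coordinate, while \<open>restrict x {..<t}\<close> and
  \<open>x t\<close> recover the pair.\<close>

lemma module_power_upd:
  assumes "y \<in> carrier (module_power M t)" "s \<in> carrier M"
  shows "y(t := s) \<in> carrier (module_power M (Suc t))"
  using assms by (auto simp: module_power_simps PiE_iff extensional_def)

lemma module_power_restrict:
  assumes "x \<in> carrier (module_power M (Suc t))"
  shows "restrict x {..<t} \<in> carrier (module_power M t)"
  using assms by (auto simp: module_power_simps PiE_iff)

lemma module_power_last:
  assumes "x \<in> carrier (module_power M (Suc t))"
  shows "x t \<in> carrier M"
  using assms by (auto simp: module_power_simps PiE_iff)

lemma module_power_upd_restrict:
  assumes "x \<in> carrier (module_power M (Suc t))"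
  shows "(restrict x {..<t})(t := x t) = x"
  using assms by (auto simp: module_power_simps PiE_iff extensional_def fun_eq_iff)

lemma module_power_restrict_upd:
  assumes "y \<in> carrier (module_power M t)"
  shows "restrict (y(t := s)) {..<t} = y"
  using assms by (auto simp: module_power_simps PiE_iff extensional_def fun_eq_iff)

lemma module_power_restrict_same:
  assumes "y \<in> carrier (module_power M t)"
  shows "restrict y {..<t} = y"
  using assms by (simp add: module_power_simps PiE_restrict)

lemma linear_map_coord:
  assumes "i < t"
  shows "linear_map R (module_power M t) M (\<lambda>x. x i)"
  using assms by (auto simp: linear_map_def module_power_simps)

lemma linear_map_power_restrict:
  "linear_map R (module_power M (Suc t)) (module_power M t) (\<lambda>x. restrict x {..<t})"
  by (auto simp: linear_map_def module_power_restrict module_power_simps(3,4) fun_eq_iff)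

lemma linear_map_power_upd:
  assumes "linear_map R L (module_power M t) f" "linear_map R L M g"
  shows "linear_map R L (module_power M (Suc t)) (\<lambda>x. (f x)(t := g x))"
proof -
  note f = linear_mapD[OF assms(1)] and g = linear_mapD[OF assms(2)]
  have "(f x)(t := g x) \<in> carrier (module_power M (Suc t))" if "x \<in> carrier L" for x
    using that by (intro module_power_upd f(1) g(1))
  moreover have "(f (x \<oplus>\<^bsub>L\<^esub> y))(t := g (x \<oplus>\<^bsub>L\<^esub> y)) =
      (f x)(t := g x) \<oplus>\<^bsub>module_power M (Suc t)\<^esub> (f y)(t := g y)"
    if "x \<in> carrier L" "y \<in> carrier L" for x y
    using that by (auto simp: f(2) g(2) module_power_simps(3) fun_eq_iff less_Suc_eq)
  moreover have "(f (a \<odot>\<^bsub>L\<^esub> x))(t := g (a \<odot>\<^bsub>L\<^esub> x)) =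
      a \<odot>\<^bsub>module_power M (Suc t)\<^esub> (f x)(t := g x)"
    if "a \<in> carrier R" "x \<in> carrier L" for a x
    using that by (auto simp: f(3) g(3) module_power_simps(4) fun_eq_iff less_Suc_eq)
  ultimately show ?thesis
    by (auto simp: linear_map_def)
qed

section \<open>Counting homomorphisms from a power\<close>

context left_module
begin

lemma linear_map_const_zero:
  assumes "left_module R L"
  shows "linear_map R L M (\<lambda>x. \<zero>\<^bsub>M\<^esub>)"
proof -
  \<comment> \<open>Writing the zero vector as the scalar zero times itself moves \<open>a\<close>
    into a product with the scalar zero.\<close>
  have "a \<odot>\<^bsub>M\<^esub> \<zero>\<^bsub>M\<^esub> = \<zero>\<^bsub>M\<^esub>" if "a \<in> carrier R" for a
    using that smult_assoc1[of a \<zero> "\<zero>\<^bsub>M\<^esub>"] smult_l_null by simp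
  then show ?thesis
    by (auto simp: linear_map_def)
qed

lemma linear_map_add:
  assumes "linear_map R L M f" "linear_map R L M g"
  shows "linear_map R L M (\<lambda>x. f x \<oplus>\<^bsub>M\<^esub> g x)"
  using linear_mapD[OF assms(1)] linear_mapD[OF assms(2)]
  by (auto simp: linear_map_def smult_r_distr M.a_ac)

lemma linear_map_last_summand:
  "linear_map R M (module_power M (Suc t)) (\<lambda>s. (\<zero>\<^bsub>module_power M t\<^esub>)(t := s))"
proof (rule linear_map_power_upd)
  interpret P: left_module R "module_power M t"
    by (rule left_module_power)
  show "linear_map R M (module_power M t) (\<lambda>s. \<zero>\<^bsub>module_power M t\<^esub>)"
    by (rule P.linear_map_const_zero) (rule left_module_axioms)
  show "linear_map R M M (\<lambda>s. s)"
    by (simp add: linear_map_def)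
qed

text \<open>A homomorphism is the sum of its restrictions to the first \<open>t\<close> coordinates
  and to the last one, and both can be prescribed freely. Each further coordinate thus contributes a
  factor \<open>card (module_End R M)\<close>.\<close>

lemma card_Hom_power: "card (module_Hom R (module_power M t) M) = card (module_End R M) ^ t"
proof (induction t)
  case 0
  interpret P: left_module R "module_power M 0"
    by (rule left_module_power)
  let ?z = "\<lambda>x\<in>carrier (module_power M 0). \<zero>\<^bsub>M\<^esub>"
  have "module_Hom R (module_power M 0) M = {?z}"
  proof (intro equalityI subsetI)
    fix f assume "f \<in> module_Hom R (module_power M 0) M"
    then have f: "linear_map R (module_power M 0) M f" "f \<in> extensional (carrier (module_power M 0))"
      by (auto simp: module_Hom_def)
    \<comment> \<open>The empty tuple \<open>\<lambda>x. undefined\<close> is the only element of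
      the zeroth power, hence its zero.\<close>
    have "f (\<lambda>x. undefined) = \<zero>\<^bsub>M\<^esub>"
      using linear_map_zero[OF P.left_module_axioms left_module_axioms f(1)]
      by (simp add: module_power_simps restrict_def)
    then have "f = ?z"
      using f(2) by (intro extensionalityI[of f "carrier (module_power M 0)"])
        (auto simp: module_power_simps)
    then show "f \<in> {?z}"
      by simp
  next
    fix f assume "f \<in> {?z}"
    then show "f \<in> module_Hom R (module_power M 0) M"
      using restrict_in_module_Hom[OF P.left_module_axioms linear_map_const_zero[OF P.left_module_axioms]]
      by simp
  qed
  then show ?case
    by simp
next
  case (Suc t)
  interpret P: left_module R "module_power M t"
    by (rule left_module_power)
  interpret P': left_module R "module_power M (Suc t)"
    by (rule left_module_power)
  let ?P = "module_power M t" and ?P' = "module_power M (Suc t)"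
  \<comment> \<open>\<open>?c\<close> glues a map on the first \<open>t\<close> coordinates to an
    endomorphism applied to the last one; its inverse \<open>?d\<close> restricts \<open>h\<close>
    to the two summands.\<close>
  let ?c = "\<lambda>(f, e). \<lambda>x\<in>carrier ?P'. f (restrict x {..<t}) \<oplus>\<^bsub>M\<^esub> e (x t)"
  let ?d = "\<lambda>h. (\<lambda>y\<in>carrier ?P. h (y(t := \<zero>\<^bsub>M\<^esub>)), \<lambda>s\<in>carrier M. h ((\<zero>\<^bsub>?P\<^esub>)(t := s)))"
  have "bij_betw ?c (module_Hom R ?P M \<times> module_Hom R M M) (module_Hom R ?P' M)"
  proof (rule bij_betw_byWitness[where f' = ?d])
    show "\<forall>p\<in>module_Hom R ?P M \<times> module_Hom R M M. ?d (?c p) = p"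
    proof
      fix p assume "p \<in> module_Hom R ?P M \<times> module_Hom R M M"
      then obtain f e where p: "p = (f, e)" "f \<in> module_Hom R ?P M" "e \<in> module_Hom R M M"
        by blast
      then have f: "linear_map R ?P M f" "f \<in> extensional (carrier ?P)"
        and e: "linear_map R M M e" "e \<in> extensional (carrier M)"
        by (auto simp: module_Hom_def)
      have "(\<lambda>y\<in>carrier ?P. ?c (f, e) (y(t := \<zero>\<^bsub>M\<^esub>))) = f"
        using linear_map_zero[OF left_module_axioms left_module_axioms e(1)] linear_mapD(1)[OF f(1)]
        by (intro extensionalityI[OF _ f(2)])
          (auto simp: module_power_restrict_same module_power_upd)
      moreover have "(\<lambda>s\<in>carrier M. ?c (f, e) ((\<zero>\<^bsub>?P\<^esub>)(t := s))) = e"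
        using linear_map_zero[OF P.left_module_axioms left_module_axioms f(1)] linear_mapD(1)[OF e(1)]
        by (intro extensionalityI[OF _ e(2)])
          (auto simp: module_power_restrict_same[OF P.zero_closed] module_power_upd)
      ultimately show "?d (?c p) = p"
        by (simp add: p(1))
    qed
    show "\<forall>h\<in>module_Hom R ?P' M. ?c (?d h) = h"
    proof
      fix h assume "h \<in> module_Hom R ?P' M"
      then have h: "linear_map R ?P' M h" "h \<in> extensional (carrier ?P')"
        by (auto simp: module_Hom_def)
      have "h ((restrict x {..<t})(t := \<zero>\<^bsub>M\<^esub>)) \<oplus>\<^bsub>M\<^esub> h ((\<zero>\<^bsub>?P\<^esub>)(t := x t)) = h x"
        if x: "x \<in> carrier ?P'" for x
      proof -
        have "(restrict x {..<t})(t := \<zero>\<^bsub>M\<^esub>) \<oplus>\<^bsub>?P'\<^esub> (\<zero>\<^bsub>?P\<^esub>)(t := x t) = x"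
          using x by (auto simp: module_power_simps PiE_iff extensional_def fun_eq_iff less_Suc_eq)
        moreover have "(restrict x {..<t})(t := \<zero>\<^bsub>M\<^esub>) \<in> carrier ?P'"
          by (rule module_power_upd[OF module_power_restrict[OF x] M.zero_closed])
        moreover have "(\<zero>\<^bsub>?P\<^esub>)(t := x t) \<in> carrier ?P'"
          by (rule module_power_upd[OF P.zero_closed module_power_last[OF x]])
        ultimately show ?thesis
          using linear_mapD(2)[OF h(1)] by metis
      qed
      then show "?c (?d h) = h"
        by (intro extensionalityI[OF _ h(2)])
          (auto simp: module_power_restrict module_power_last)
    qed
    show "?c ` (module_Hom R ?P M \<times> module_Hom R M M) \<subseteq> module_Hom R ?P' M"
    proof (rule image_subsetI)
      fix p assume "p \<in> module_Hom R ?P M \<times> module_Hom R M M"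
      then obtain f e where p: "p = (f, e)" "linear_map R ?P M f" "linear_map R M M e"
        by (auto simp: module_Hom_def)
      have "linear_map R ?P' M (\<lambda>x. f (restrict x {..<t}) \<oplus>\<^bsub>M\<^esub> e (x t))"
        using linear_map_add linear_map_compose[OF linear_map_power_restrict p(2)]
          linear_map_compose[OF linear_map_coord[OF lessI] p(3)] by blast
      then show "?c p \<in> module_Hom R ?P' M"
        using restrict_in_module_Hom[OF P'.left_module_axioms] by (simp add: p(1))
    qed
    have "linear_map R ?P ?P' (\<lambda>y. y(t := \<zero>\<^bsub>M\<^esub>))"
      using linear_map_const_zero[OF P.left_module_axioms]
      by (intro linear_map_power_upd[of R ?P M t "\<lambda>y. y"]) (auto simp: linear_map_def)
    then have "?d h \<in> module_Hom R ?P M \<times> module_Hom R M M" if "linear_map R ?P' M h" for h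
      using restrict_in_module_Hom[OF P.left_module_axioms linear_map_compose[OF _ that]]
        restrict_in_module_Hom[OF left_module_axioms linear_map_compose[OF linear_map_last_summand that]]
      by blast
    then show "?d ` module_Hom R ?P' M \<subseteq> module_Hom R ?P M \<times> module_Hom R M M"
      by (intro image_subsetI) (simp add: module_Hom_def)
  qed
  then have "card (module_Hom R ?P' M) = card (module_Hom R ?P M \<times> module_Hom R M M)"
    by (simp add: bij_betw_same_card)
  then show ?case
    by (simp add: Suc.IH card_cartesian_product module_End_eq_Hom)
qed

end

section \<open>Finiteness of the submodule lattice of a power\<close>

context simple_left_module
begin

text \<open>One half of Schur's lemma: the image is a nonzero submodule of a simple module.\<close>

lemma linear_map_surj:
  assumes "left_module R L" "linear_map R L M f" "x \<in> carrier L" "f x \<noteq> \<zero>\<^bsub>M\<^esub>"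
  shows "f ` carrier L = carrier M"
proof -
  interpret L: left_module R L by fact
  have "submodule (carrier L) R L"
    using L.carrier_in_submodules by (simp add: submodules_def)
  then have "submodule (f ` carrier L) R M"
    by (rule submodule_image[OF assms(1) left_module_axioms assms(2)])
  then show ?thesis
    using submodule_trivial assms(3,4) by blast
qed

text \<open>
  A homomorphism \<open>S \<rightarrow> S\<^sup>t\<close> is encoded as the tuple \<open>\<phi>\<close> of its components. An element \<open>y \<noteq> 0\<close> of \<open>X\<close> of
  minimal support has the property that the elements of \<open>X\<close> supported on \<open>supp y\<close> form a copy of \<open>S\<close>,
  mapped isomorphically by each coordinate in \<open>supp y\<close>; subtracting a suitable one from \<open>x \<in> X\<close> shrinks
  the support of \<open>x\<close>.
\<close>

lemma submodule_power_subset: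
  assumes X: "submodule X R (module_power M t)" and Z: "submodule Z R (module_power M t)"
    and HX: "\<And>\<phi>. \<phi> \<in> {..<t} \<rightarrow>\<^sub>E module_End R M \<Longrightarrow> (\<forall>s\<in>carrier M. (\<lambda>i\<in>{..<t}. \<phi> i s) \<in> X) \<Longrightarrow>
      (\<forall>s\<in>carrier M. (\<lambda>i\<in>{..<t}. \<phi> i s) \<in> Z)"
  shows "X \<subseteq> Z"
proof
  let ?P = "module_power M t"
  interpret P: left_module R ?P
    by (rule left_module_power)
  define supp where "supp x = {i. i < t \<and> x i \<noteq> \<zero>\<^bsub>M\<^esub>}" for x :: "nat \<Rightarrow> 'c"
  have fin: "finite (supp x)" for x
    by (rule finite_subset[of _ "{..<t}"]) (auto simp: supp_def)
  have XP: "x \<in> carrier ?P" if "x \<in> X" for x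
    using that X by (auto simp: P.submodule_iff)
  have coord: "x i \<in> carrier M" if "x \<in> carrier ?P" "i < t" for x i
    using that by (auto simp: module_power_simps)
  have supp_empty: "x = \<zero>\<^bsub>?P\<^esub>" if "x \<in> carrier ?P" "supp x = {}" for x
    using that by (intro module_power_eqI[of _ M t]) (auto simp: supp_def module_power_simps)
  fix x assume "x \<in> X"
  then show "x \<in> Z"
  proof (induction "card (supp x)" arbitrary: x rule: less_induct)
    case (less x)
    show ?case
    proof (cases "x = \<zero>\<^bsub>?P\<^esub>")
      case True
      then show ?thesis
        using Z by (simp add: P.submodule_iff)
    next
      case False
      \<comment> \<open>Minimality is asked only among supports inside \<open>supp x\<close>, so
        that subtracting an element supported on \<open>supp y\<close> cannot enlarge the support of
        \<open>x\<close>.\<close>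
      let ?Q = "\<lambda>y. y \<in> X \<and> y \<noteq> \<zero>\<^bsub>?P\<^esub> \<and> supp y \<subseteq> supp x"
      obtain y where y: "?Q y" and min: "\<And>z. ?Q z \<Longrightarrow> card (supp y) \<le> card (supp z)"
        using ex_has_least_nat[of ?Q x "\<lambda>y. card (supp y)"] False less.prems by blast
      obtain j where j: "j \<in> supp y"
        using y XP supp_empty by blast
      then have "j < t" "y j \<noteq> \<zero>\<^bsub>M\<^esub>"
        by (auto simp: supp_def)
      define Y where "Y = {z \<in> X. \<forall>i<t. i \<notin> supp y \<longrightarrow> z i = \<zero>\<^bsub>M\<^esub>}"
      have smult_zero: "a \<odot>\<^bsub>M\<^esub> \<zero>\<^bsub>M\<^esub> = \<zero>\<^bsub>M\<^esub>" if "a \<in> carrier R" for a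
        using linear_mapD(3)[OF linear_map_const_zero[OF left_module_axioms] that M.zero_closed] by simp
      have YX: "Y \<subseteq> X" and Ysupp: "\<And>z. z \<in> Y \<Longrightarrow> supp z \<subseteq> supp y"
        by (auto simp: Y_def supp_def)
      have Y: "submodule Y R ?P"
        unfolding P.submodule_iff
      proof (intro conjI ballI)
        show "Y \<subseteq> carrier ?P"
          using YX XP by blast
        show "\<zero>\<^bsub>?P\<^esub> \<in> Y"
          using X by (simp add: Y_def P.submodule_iff) (simp add: module_power_simps)
        show "u \<oplus>\<^bsub>?P\<^esub> v \<in> Y" if "u \<in> Y" "v \<in> Y" for u v
          using that X by (simp add: Y_def P.submodule_iff) (simp add: module_power_simps)
        show "a \<odot>\<^bsub>?P\<^esub> u \<in> Y" if "a \<in> carrier R" "u \<in> Y" for a u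
          using that X by (simp add: Y_def P.submodule_iff) (simp add: module_power_simps smult_zero)
      qed
      let ?Y = "?P\<lparr>carrier := Y\<rparr>"
      interpret Y: left_module R ?Y
        by (rule P.left_module_submodule[OF Y])
      have yY: "y \<in> Y"
        using y by (auto simp: Y_def supp_def)
      have pr: "linear_map R ?Y M (\<lambda>z. z j)"
        by (intro linear_map_subdomain P.left_module_axioms Y linear_map_coord \<open>j < t\<close>)
      \<comment> \<open>An element of \<open>Y\<close> that vanishes at \<open>j\<close> has support
        strictly inside \<open>supp y\<close>, so minimality forces it to be zero.\<close>
      have "inj_on (\<lambda>z. z j) (carrier ?Y)"
      proof (rule linear_map_inj_on[OF Y.left_module_axioms left_module_axioms pr])
        fix z assume "z \<in> carrier ?Y" and zj: "z j = \<zero>\<^bsub>M\<^esub>"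
        then have z: "z \<in> Y"
          by simp
        have "supp z \<subset> supp y"
          using Ysupp[OF z] j zj by (auto simp: supp_def)
        then have "card (supp z) < card (supp y)" "supp z \<subseteq> supp x"
          using fin y by (auto intro: psubset_card_mono)
        then show "z = \<zero>\<^bsub>?Y\<^esub>"
          using min[of z] z YX by fastforce
      qed
      moreover have "(\<lambda>z. z j) ` carrier ?Y = carrier M"
        using linear_map_surj[OF Y.left_module_axioms pr, of y] yY \<open>y j \<noteq> _\<close> by simp
      ultimately have bij: "bij_betw (\<lambda>z. z j) (carrier ?Y) (carrier M)"
        by (simp add: bij_betw_def)
      \<comment> \<open>Inverting the coordinate \<open>j\<close> gives a homomorphism from
        \<open>M\<close> into \<open>X\<close>; its components form the tuple \<open>\<phi>\<close>
        to which \<open>HX\<close> applies, and \<open>HX\<close> carries its image into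
        \<open>Z\<close>.\<close>
      define g where "g = inv_into (carrier ?Y) (\<lambda>z. z j)"
      have "linear_map R M ?Y g"
        unfolding g_def by (rule linear_map_inv_into[OF Y.left_module_axioms pr bij])
      then have g: "linear_map R M ?P g"
        using linear_map_compose[OF _ linear_map_inclusion[OF P.left_module_axioms Y]] by blast
      have gY: "g s \<in> Y" and gj: "g s j = s" if "s \<in> carrier M" for s
        using that bij bij_betw_inv_into_right[OF bij that] bij_betw_inv_into[OF bij]
        by (auto simp: g_def bij_betw_def)
      define \<phi> where "\<phi> = (\<lambda>i\<in>{..<t}. \<lambda>s\<in>carrier M. g s i)"
      have "\<phi> \<in> {..<t} \<rightarrow>\<^sub>E module_End R M"
        unfolding \<phi>_def module_End_eq_Hom
        by (intro restrict_PiE_iff[THEN iffD2] ballI restrict_in_module_Hom left_module_axioms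
            linear_map_compose[OF g linear_map_coord]) simp
      moreover have \<phi>g: "(\<lambda>i\<in>{..<t}. \<phi> i s) = g s" if "s \<in> carrier M" for s
        using gY[OF that] YX XP that
        by (intro module_power_eqI[of _ M t]) (auto simp: \<phi>_def module_power_simps coord)
      ultimately have gZ: "g s \<in> Z" if "s \<in> carrier M" for s
        using HX[of \<phi>] gY YX that by auto
      \<comment> \<open>Chosen to agree with \<open>x\<close> at \<open>j\<close>: the difference
        \<open>w\<close> of \<open>x\<close> and \<open>z\<close> vanishes at \<open>j\<close> and
        outside \<open>supp x\<close>, so the induction hypothesis puts it into
        \<open>Z\<close>.\<close>
      define z where "z = g (x j)"
      have xj: "x j \<in> carrier M"
        using less.prems XP coord \<open>j < t\<close> by blast
      have z: "z \<in> X" "z \<in> Z" "z \<in> Y" "z j = x j"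
        using gY[OF xj] gZ[OF xj] gj[OF xj] YX by (auto simp: z_def)
      define w where "w = x \<oplus>\<^bsub>?P\<^esub> ((\<ominus> \<one>) \<odot>\<^bsub>?P\<^esub> z)"
      have w: "w \<in> X"
        using less.prems z(1) X by (simp add: w_def P.submodule_iff)
      have wi: "w i = x i \<oplus>\<^bsub>M\<^esub> (\<ominus>\<^bsub>M\<^esub> z i)" if "i < t" for i
        using that z(1) XP coord by (simp add: w_def module_power_simps(3,4) smult_minus_one)
      have xjx: "j \<in> supp x" "supp y \<subseteq> supp x"
        using y j by auto
      have "w i = \<zero>\<^bsub>M\<^esub>" if "i < t" "i \<notin> supp x \<or> i = j" for i
      proof (cases "i = j")
        case True
        then show ?thesis
          using wi[OF \<open>i < t\<close>] z(4) xj by (simp add: M.r_neg)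
      next
        case False
        then have "x i = \<zero>\<^bsub>M\<^esub>" "z i = \<zero>\<^bsub>M\<^esub>"
          using that xjx z(3) by (auto simp: supp_def Y_def)
        then show ?thesis
          using wi[OF \<open>i < t\<close>] by (simp add: M.r_neg)
      qed
      then have "supp w \<subset> supp x"
        using xjx(1) by (auto simp: supp_def)
      then have "w \<in> Z"
        using less.hyps[of w] w fin by (simp add: psubset_card_mono)
      moreover have "w \<oplus>\<^bsub>?P\<^esub> z = x"
      proof (rule module_power_eqI)
        show "w \<oplus>\<^bsub>?P\<^esub> z \<in> carrier ?P" "x \<in> carrier ?P"
          using w z(1) less.prems XP by auto
        show "(w \<oplus>\<^bsub>?P\<^esub> z) i = x i" if "i < t" for i
          using that z(1) less.prems XP wi coord
          by (simp add: module_power_simps(3) M.a_assoc M.l_neg)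
      qed
      ultimately show ?thesis
        using z(2) Z unfolding P.submodule_iff by blast
    qed
  qed
qed

lemma finite_submodules_power:
  assumes "finite (module_End R M)"
  shows "finite (submodules R (module_power M t))"
proof -
  \<comment> \<open>All homomorphisms from \<open>M\<close> into \<open>X\<close>, as tuples. The
    preceding lemma, used in both directions, makes \<open>H\<close> injective, and its values are
    subsets of a finite set.\<close>
  define H where "H X = {\<phi> \<in> {..<t} \<rightarrow>\<^sub>E module_End R M. \<forall>s\<in>carrier M. (\<lambda>i\<in>{..<t}. \<phi> i s) \<in> X}" for X
  have "X \<subseteq> Z" if "X \<in> submodules R (module_power M t)" "Z \<in> submodules R (module_power M t)" "H X = H Z"
    for X Z
    using that by (intro submodule_power_subset[of X t Z]) (auto simp: submodules_def H_def)
  then have "inj_on H (submodules R (module_power M t))"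
    by (intro inj_onI subset_antisym) auto
  moreover have "finite (H ` submodules R (module_power M t))"
    by (rule finite_subset[of _ "Pow ({..<t} \<rightarrow>\<^sub>E module_End R M)"])
      (use assms in \<open>auto simp: H_def intro: finite_PiE\<close>)
  ultimately show ?thesis
    by (rule finite_imageD[rotated])
qed

end

section \<open>Graphs as complements of the last summand\<close>

text \<open>The value \<open>f y\<close> is stored as coordinate \<open>t\<close>, so that the graph
  is a subset of the next power rather than a set of pairs.\<close>

definition power_graph :: "('a, 'b, 'm) module_scheme \<Rightarrow> nat \<Rightarrow> ((nat \<Rightarrow> 'b) \<Rightarrow> 'b) \<Rightarrow> (nat \<Rightarrow> 'b) set"
  where "power_graph M t f = (\<lambda>y. y(t := f y)) ` carrier (module_power M t)"

definition last_summand :: "('a, 'b, 'm) module_scheme \<Rightarrow> nat \<Rightarrow> (nat \<Rightarrow> 'b) set"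
  where "last_summand M t = (\<lambda>s. (\<zero>\<^bsub>module_power M t\<^esub>)(t := s)) ` carrier M"

lemma linear_map_graph:
  assumes "linear_map R (module_power M t) M f"
  shows "linear_map R (module_power M t) (module_power M (Suc t)) (\<lambda>y. y(t := f y))"
  by (rule linear_map_power_upd[OF _ assms]) (simp add: linear_map_def)

lemma inj_on_power_upd: "inj_on (\<lambda>y. y(t := f y)) (carrier (module_power M t))"
  by (rule inj_on_inverseI[of _ "\<lambda>x. restrict x {..<t}"]) (rule module_power_restrict_upd)

context left_module
begin

lemma submodule_graph:
  assumes "linear_map R (module_power M t) M f"
  shows "submodule (power_graph M t f) R (module_power M (Suc t))"
proof -
  interpret P: left_module R "module_power M t"
    by (rule left_module_power)
  have "submodule (carrier (module_power M t)) R (module_power M t)"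
    using P.carrier_in_submodules by (simp add: submodules_def)
  then show ?thesis
    unfolding power_graph_def
    by (rule submodule_image[OF left_module_power left_module_power linear_map_graph[OF assms]])
qed

lemma submodule_last_summand: "submodule (last_summand M t) R (module_power M (Suc t))"
proof -
  have "submodule (carrier M) R M"
    using carrier_in_submodules by (simp add: submodules_def)
  then show ?thesis
    unfolding last_summand_def
    by (rule submodule_image[OF left_module_axioms left_module_power linear_map_last_summand])
qed

text \<open>Appending \<open>f y\<close> to \<open>y\<close> is an isomorphism from the power onto
  the graph, with restriction to \<open>{..<t}\<close> as its inverse.\<close>

lemma submodule_mu_graph:
  assumes "linear_map R (module_power M t) M f"
  shows "submodule_mu R ((module_power M (Suc t))\<lparr>carrier := power_graph M t f\<rparr>) =
    submodule_mu R (module_power M t)"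
proof -
  let ?P = "module_power M t" and ?Q = "(module_power M (Suc t))\<lparr>carrier := power_graph M t f\<rparr>"
  interpret P': left_module R "module_power M (Suc t)"
    by (rule left_module_power)
  have "linear_map R ?P ?Q (\<lambda>y. y(t := f y))"
    using linear_map_graph[OF assms] by (auto simp: linear_map_def power_graph_def)
  moreover have "bij_betw (\<lambda>y. y(t := f y)) (carrier ?P) (carrier ?Q)"
    by (simp add: bij_betw_def power_graph_def inj_on_power_upd)
  ultimately show ?thesis
    by (rule submodule_mu_iso[OF left_module_power P'.left_module_submodule[OF submodule_graph[OF assms]],
          symmetric])
qed

text \<open>The graph fixes the values on the carrier, and extensionality fixes the rest. Hence
  there are as many graphs as homomorphisms.\<close>

lemma inj_on_power_graph: "inj_on (power_graph M t) (module_Hom R (module_power M t) M)"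
proof (rule inj_onI)
  fix f g assume f: "f \<in> module_Hom R (module_power M t) M" and g: "g \<in> module_Hom R (module_power M t) M"
    and eq: "power_graph M t f = power_graph M t g"
  show "f = g"
  proof (rule extensionalityI)
    show "f \<in> extensional (carrier (module_power M t))" "g \<in> extensional (carrier (module_power M t))"
      using f g by (auto simp: module_Hom_def)
    fix y assume y: "y \<in> carrier (module_power M t)"
    then have "y(t := f y) \<in> power_graph M t g"
      unfolding eq[symmetric] by (simp add: power_graph_def)
    then obtain z where z: "z \<in> carrier (module_power M t)" "y(t := f y) = z(t := g z)"
      by (auto simp: power_graph_def)
    then have "y = z"
      using module_power_restrict_upd y by metis
    then show "f y = g y"
      using fun_cong[OF z(2), of t] by simp
  qed
qed

text \<open>With \<open>y\<close> the first \<open>t\<close> coordinates of \<open>x\<close>,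
  subtracting the point of the graph over \<open>y\<close> from \<open>x\<close> leaves an element
  whose only possibly nonzero coordinate is the last.\<close>

lemma graph_add_last_summand:
  assumes "linear_map R (module_power M t) M f"
  shows "power_graph M t f <+>\<^bsub>module_power M (Suc t)\<^esub> last_summand M t = carrier (module_power M (Suc t))"
proof
  let ?P = "module_power M t" and ?P' = "module_power M (Suc t)"
  interpret P: left_module R ?P
    by (rule left_module_power)
  interpret P': left_module R ?P'
    by (rule left_module_power)
  show "power_graph M t f <+>\<^bsub>?P'\<^esub> last_summand M t \<subseteq> carrier ?P'"
    using P'.submodule_set_add[OF submodule_graph[OF assms] submodule_last_summand]
    by (simp add: P'.submodule_iff)
  show "carrier ?P' \<subseteq> power_graph M t f <+>\<^bsub>?P'\<^esub> last_summand M t"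
  proof
    fix x assume x: "x \<in> carrier ?P'"
    define y where "y = restrict x {..<t}"
    define s where "s = (\<ominus>\<^bsub>M\<^esub> f y) \<oplus>\<^bsub>M\<^esub> x t"
    have y: "y \<in> carrier ?P" and xt: "x t \<in> carrier M"
      using module_power_restrict[OF x] module_power_last[OF x] by (auto simp: y_def)
    then have fy: "f y \<in> carrier M"
      using linear_mapD(1)[OF assms] by simp
    have s: "s \<in> carrier M" "f y \<oplus>\<^bsub>M\<^esub> s = x t"
      using xt fy by (auto simp: s_def M.r_neg2)
    have "x i \<oplus>\<^bsub>M\<^esub> \<zero>\<^bsub>M\<^esub> = x i" if "i < t" for i
      using that x by (simp add: module_power_simps PiE_iff)
    then have "y(t := f y) \<oplus>\<^bsub>?P'\<^esub> (\<zero>\<^bsub>?P\<^esub>)(t := s) = x"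
      using x s(2)
      by (auto simp: y_def module_power_simps(2,3) less_Suc_eq fun_eq_iff)
        (auto simp: module_power_simps(1) PiE_iff extensional_def)
    then show "x \<in> power_graph M t f <+>\<^bsub>?P'\<^esub> last_summand M t"
      using y s(1) unfolding set_add_def' power_graph_def last_summand_def by blast
  qed
qed

end

context simple_left_module
begin

lemma exists_nonzero: "\<exists>s\<in>carrier M. s \<noteq> \<zero>\<^bsub>M\<^esub>"
  using carrier_nonzero M.zero_closed by blast

text \<open>The last summand is simple, so \<open>X\<close> either contains it, and then
  \<open>X\<close> equals the sum and is everything, or meets it in zero. In the latter case
  forgetting coordinate \<open>t\<close> is an isomorphism from \<open>X\<close> onto the power, and
  the last coordinate of its inverse is the homomorphism sought.\<close>

lemma submodule_eq_graph:
  assumes X: "submodule X R (module_power M (Suc t))"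
    and add: "X <+>\<^bsub>module_power M (Suc t)\<^esub> last_summand M t = carrier (module_power M (Suc t))"
    and ne: "X \<noteq> carrier (module_power M (Suc t))"
  shows "X \<in> power_graph M t ` module_Hom R (module_power M t) M"
proof -
  let ?P = "module_power M t" and ?P' = "module_power M (Suc t)"
  let ?\<iota> = "\<lambda>s. (\<zero>\<^bsub>?P\<^esub>)(t := s)"
  interpret P: left_module R ?P
    by (rule left_module_power)
  interpret P': left_module R ?P'
    by (rule left_module_power)
  have XP: "X \<subseteq> carrier ?P'"
    using X by (simp add: P'.submodule_iff)
  have "submodule {s \<in> carrier M. ?\<iota> s \<in> X} R M"
    by (rule submodule_vimage[OF left_module_axioms P'.left_module_axioms linear_map_last_summand X])
  moreover have "{s \<in> carrier M. ?\<iota> s \<in> X} \<noteq> carrier M"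
  proof
    assume "{s \<in> carrier M. ?\<iota> s \<in> X} = carrier M"
    then have "last_summand M t \<subseteq> X"
      by (auto simp: last_summand_def)
    then have "carrier ?P' \<subseteq> X"
      using P'.set_add_subset_iff[OF X submodule_last_summand X] by (simp add: add)
    then show False
      using XP ne by simp
  qed
  ultimately have triv: "{s \<in> carrier M. ?\<iota> s \<in> X} = {\<zero>\<^bsub>M\<^esub>}"
    using submodule_trivial by blast
  let ?X = "?P'\<lparr>carrier := X\<rparr>" and ?\<rho> = "\<lambda>x. restrict x {..<t}"
  interpret X: left_module R ?X
    by (rule P'.left_module_submodule[OF X])
  have \<rho>: "linear_map R ?X ?P ?\<rho>"
    by (rule linear_map_subdomain[OF P'.left_module_axioms X linear_map_power_restrict])
  \<comment> \<open>The kernel of \<open>?\<rho>\<close> on \<open>X\<close> is the intersection of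
    \<open>X\<close> with the last summand, which is zero by \<open>triv\<close>.\<close>
  have "inj_on ?\<rho> (carrier ?X)"
  proof (rule linear_map_inj_on[OF X.left_module_axioms P.left_module_axioms \<rho>])
    fix x assume "x \<in> carrier ?X" and 0: "?\<rho> x = \<zero>\<^bsub>?P\<^esub>"
    then have x: "x \<in> X" "x \<in> carrier ?P'"
      using XP by auto
    have "?\<iota> (x t) = x"
      using module_power_upd_restrict[OF x(2)] by (simp only: 0)
    then have "x t \<in> {s \<in> carrier M. ?\<iota> s \<in> X}"
      using x(1) module_power_last[OF x(2)] by simp
    then have "x t = \<zero>\<^bsub>M\<^esub>"
      unfolding triv by simp
    moreover have "?\<iota> \<zero>\<^bsub>M\<^esub> = \<zero>\<^bsub>?P'\<^esub>"
      by (rule linear_map_zero[OF left_module_axioms P'.left_module_axioms linear_map_last_summand])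
    ultimately show "x = \<zero>\<^bsub>?X\<^esub>"
      using \<open>?\<iota> (x t) = x\<close> by simp
  qed
  moreover have "?\<rho> ` carrier ?X = carrier ?P"
  proof
    show "?\<rho> ` carrier ?X \<subseteq> carrier ?P"
      using linear_mapD(1)[OF \<rho>] by blast
    show "carrier ?P \<subseteq> ?\<rho> ` carrier ?X"
    proof
      fix y assume y: "y \<in> carrier ?P"
      obtain s0 where s0: "s0 \<in> carrier M"
        using M.zero_closed by blast
      \<comment> \<open>Any lift of \<open>y\<close> will do: it is an element of \<open>X\<close>
        plus one of the last summand, and \<open>?\<rho>\<close> kills the latter.\<close>
      have "y(t := s0) \<in> X <+>\<^bsub>?P'\<^esub> last_summand M t"
        unfolding add by (rule module_power_upd[OF y s0])
      then obtain x s where x: "x \<in> X" "s \<in> carrier M" "y(t := s0) = x \<oplus>\<^bsub>?P'\<^esub> ?\<iota> s"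
        unfolding set_add_def' last_summand_def by blast
      have xP: "x \<in> carrier ?P'"
        using x(1) XP by blast
      have "?\<rho> (?\<iota> s) = \<zero>\<^bsub>?P\<^esub>"
        by (rule module_power_restrict_upd[OF P.zero_closed])
      moreover have "?\<iota> s \<in> carrier ?P'"
        by (rule module_power_upd[OF P.zero_closed x(2)])
      ultimately have "?\<rho> (y(t := s0)) = ?\<rho> x"
        unfolding x(3) linear_mapD(2)[OF linear_map_power_restrict xP \<open>?\<iota> s \<in> carrier ?P'\<close>]
        using module_power_restrict[OF xP] by simp
      then have "y = ?\<rho> x"
        by (simp only: module_power_restrict_upd[OF y])
      then show "y \<in> ?\<rho> ` carrier ?X"
        using x(1) by simp
    qed
  qed
  ultimately have bij: "bij_betw ?\<rho> (carrier ?X) (carrier ?P)"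
    by (simp add: bij_betw_def)
  define g where "g = inv_into (carrier ?X) ?\<rho>"
  have "linear_map R ?P ?X g"
    unfolding g_def by (rule linear_map_inv_into[OF X.left_module_axioms \<rho> bij])
  then have g: "linear_map R ?P ?P' g"
    using linear_map_compose[OF _ linear_map_inclusion[OF P'.left_module_axioms X]] by blast
  define f where "f = (\<lambda>y\<in>carrier ?P. g y t)"
  have f: "f \<in> module_Hom R ?P M"
    unfolding f_def
    by (rule restrict_in_module_Hom[OF P.left_module_axioms linear_map_compose[OF g linear_map_coord[OF lessI]]])
  have "g y = y(t := f y)" if y: "y \<in> carrier ?P" for y
  proof -
    have "?\<rho> (g y) = y"
      unfolding g_def by (rule bij_betw_inv_into_right[OF bij y])
    then show ?thesis
      using module_power_upd_restrict[OF linear_mapD(1)[OF g y]] y by (simp add: f_def)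
  qed
  then have "power_graph M t f = g ` carrier ?P"
    by (simp add: power_graph_def)
  also have "\<dots> = X"
    using bij_betw_inv_into[OF bij] by (simp add: g_def bij_betw_def)
  finally show ?thesis
    using f by blast
qed

text \<open>A graph meets the last summand only in zero, while \<open>M\<close> has a nonzero
  element. This keeps the term of the whole module apart from the graph terms in Weisner's
  sum.\<close>

lemma carrier_not_graph:
  assumes "linear_map R (module_power M t) M f"
  shows "power_graph M t f \<noteq> carrier (module_power M (Suc t))"
proof
  interpret P: left_module R "module_power M t"
    by (rule left_module_power)
  assume eq: "power_graph M t f = carrier (module_power M (Suc t))"
  obtain s where s: "s \<in> carrier M" "s \<noteq> \<zero>\<^bsub>M\<^esub>"
    using exists_nonzero by blast
  have "(\<zero>\<^bsub>module_power M t\<^esub>)(t := s) \<in> power_graph M t f"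
    unfolding eq by (rule module_power_upd[OF P.zero_closed s(1)])
  then obtain y where y: "y \<in> carrier (module_power M t)" "(\<zero>\<^bsub>module_power M t\<^esub>)(t := s) = y(t := f y)"
    by (auto simp: power_graph_def)
  then have "y = \<zero>\<^bsub>module_power M t\<^esub>"
    using module_power_restrict_upd[OF P.zero_closed] module_power_restrict_upd[OF y(1)] by metis
  then have "f y = \<zero>\<^bsub>M\<^esub>"
    using linear_map_zero[OF P.left_module_axioms left_module_axioms assms] by simp
  then show False
    using s(2) fun_cong[OF y(2), of t] by simp
qed

lemma submodules_add_last_summand:
  "{X \<in> submodules R (module_power M (Suc t)).
      X <+>\<^bsub>module_power M (Suc t)\<^esub> last_summand M t = carrier (module_power M (Suc t))} =
    insert (carrier (module_power M (Suc t))) (power_graph M t ` module_Hom R (module_power M t) M)"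
    (is "?L = insert ?C ?G")
proof
  let ?P' = "module_power M (Suc t)"
  interpret P': left_module R ?P'
    by (rule left_module_power)
  show "?L \<subseteq> insert ?C ?G"
    using submodule_eq_graph by (auto simp: submodules_def)
  have C: "submodule ?C R ?P'"
    using P'.carrier_in_submodules by (simp add: submodules_def)
  have "?C <+>\<^bsub>?P'\<^esub> last_summand M t = ?C"
  proof
    show "?C <+>\<^bsub>?P'\<^esub> last_summand M t \<subseteq> ?C"
      using P'.submodule_set_add[OF C submodule_last_summand] by (simp add: P'.submodule_iff)
    show "?C \<subseteq> ?C <+>\<^bsub>?P'\<^esub> last_summand M t"
      using P'.set_add_subset_iff[OF C submodule_last_summand
          P'.submodule_set_add[OF C submodule_last_summand]] by blast
  qed
  then show "insert ?C ?G \<subseteq> ?L"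
    using C submodule_graph graph_add_last_summand
    by (auto simp: submodules_def module_Hom_def)
qed

section \<open>The recursion in the exponent and its solution\<close>

lemma submodule_mu_power_Suc:
  assumes "finite (module_End R M)"
  shows "submodule_mu R (module_power M (Suc t)) =
    - (int (card (module_End R M)) ^ t * submodule_mu R (module_power M t))"
proof -
  let ?P = "module_power M t" and ?P' = "module_power M (Suc t)"
  interpret P': left_module R ?P'
    by (rule left_module_power)
  let ?H = "module_Hom R ?P M"
  let ?\<mu> = "\<lambda>X. submodule_mu R (?P'\<lparr>carrier := X\<rparr>)"
  have fin: "finite (submodules R ?P')"
    by (rule finite_submodules_power[OF assms])
  have "last_summand M t \<noteq> {\<zero>\<^bsub>?P'\<^esub>}"
  proof
    assume eq: "last_summand M t = {\<zero>\<^bsub>?P'\<^esub>}"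
    obtain s where s: "s \<in> carrier M" "s \<noteq> \<zero>\<^bsub>M\<^esub>"
      using exists_nonzero by blast
    then have "(\<zero>\<^bsub>?P\<^esub>)(t := s) = \<zero>\<^bsub>?P'\<^esub>"
      using eq by (auto simp: last_summand_def)
    then have "s = \<zero>\<^bsub>?P'\<^esub> t"
      by (metis fun_upd_same)
    then show False
      using s(2) by (simp add: module_power_simps)
  qed
  moreover have "submodule (carrier ?P') R ?P'"
    using P'.carrier_in_submodules by (simp add: submodules_def)
  moreover have "last_summand M t \<subseteq> carrier ?P'"
    using submodule_last_summand[of t] by (simp add: P'.submodule_iff)
  ultimately have "(\<Sum>X | X \<in> submodules R ?P' \<and> X <+>\<^bsub>?P'\<^esub> last_summand M t = carrier ?P'. ?\<mu> X) = 0"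
    by (intro P'.sum_mu_set_add_eq[OF fin submodule_last_summand])
  then have "(\<Sum>X\<in>insert (carrier ?P') (power_graph M t ` ?H). ?\<mu> X) = 0"
    by (simp only: submodules_add_last_summand)
  moreover have "finite (power_graph M t ` ?H)"
    by (rule finite_subset[OF _ fin]) (use submodule_graph in \<open>auto simp: submodules_def module_Hom_def\<close>)
  moreover have "carrier ?P' \<notin> power_graph M t ` ?H"
    using carrier_not_graph by (auto simp: module_Hom_def)
  \<comment> \<open>Restricting \<open>?P'\<close> to its own carrier changes nothing, so the first
    term is the value to be solved for.\<close>
  ultimately have "?\<mu> (carrier ?P') + (\<Sum>X\<in>power_graph M t ` ?H. ?\<mu> X) = 0"
    by simp
  \<comment> \<open>All graph terms are equal, which reduces the sum to the number of homomorphisms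
    times one value.\<close>
  also have "(\<Sum>X\<in>power_graph M t ` ?H. ?\<mu> X) = (\<Sum>f\<in>?H. submodule_mu R ?P)"
    unfolding sum.reindex[OF inj_on_power_graph]
    by (intro sum.cong) (auto simp: submodule_mu_graph module_Hom_def)
  also have "\<dots> = int (card (module_End R M)) ^ t * submodule_mu R ?P"
    by (simp add: card_Hom_power)
  finally show ?thesis
    by simp
qed

lemma submodule_mu_power:
  assumes "finite (module_End R M)"
  shows "submodule_mu R (module_power M t) =
    (-1) ^ t * int (card (module_End R M)) ^ (t * (t - 1) div 2)"
proof (induction t)
  case 0
  have "carrier (module_power M 0) = {\<zero>\<^bsub>module_power M 0\<^esub>}"
    by (simp add: module_power_simps restrict_def)
  then show ?case
    using submodule_mu_zero[OF left_module_power] by simp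
next
  case (Suc t)
  \<comment> \<open>The exponent must grow by \<open>t\<close>. The identity is stated before
    halving, where the added \<open>2 * t\<close> makes the division harmless; the case
    \<open>t = 0\<close> is split off because of truncated subtraction.\<close>
  have "Suc t * (Suc t - 1) = t * (t - 1) + 2 * t"
    by (cases t) auto
  then have "Suc t * (Suc t - 1) div 2 = t * (t - 1) div 2 + t"
    by simp
  then show ?case
    by (simp only: submodule_mu_power_Suc[OF assms] Suc.IH) (simp add: power_add)
qed

end

text \<open>Finiteness is stated beside the cardinality because \<open>card\<close> is 0 on infinite
  sets; together they say that there are exactly \<open>q\<close> endomorphisms.\<close>

theorem lemma27:
  fixes R :: "('a, 'c) ring_scheme" and S :: "('a, 'b, 'm) module_scheme" and t q :: nat
  assumes "ring R"
    and "simple_left_module R S"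
    and "finite (module_End R S)"
    and "card (module_End R S) = q"
  shows "submodule_mu R (module_power S t) = (-1) ^ t * int q ^ (t * (t - 1) div 2)"
  using simple_left_module.submodule_mu_power[OF assms(2,3)] assms(4) by simp

end
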